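(* Let $G$ be a connected graph with $l$ vertices and let $K_{m,n}$ be a complete bipartite graph. (i) If $K_{m,n}$ is of QE class and $G$ is of non-QE class, then $\mathrm{QEC}(K_{m,n}\times G)=(m+n)\,\mathrm{QEC}(G)$. (ii) If $K_{m,n}$ is of non-QE class, then $$\mathrm{QEC}(K_{m,n}\times G)=\max\left\{(m+n)\,\mathrm{QEC}(G),\ l\,\frac{n(m-2)+m(n-2)}{m+n}\right\}.$$
   Context: All graphs are finite, simple and unweighted. $K_{m,n}$ denotes the complete bipartite graph on $m+n$ vertices with parts of sizes $m$ and $n$. For a connected graph $G=(V,E)$, $D_G$ is its distance matrix (the $(v,w)$ entry is the length of a shortest path connecting $v$ and $w$, with zero diagonal), and the quadratic embedding constant is $\mathrm{QEC}(G):=\max\{\langle f,D_Gf\rangle : f\in C(V),\ \langle f,f\rangle=1,\ \langle e,f\rangle=0\}$, where $C(V)\cong\mathbb{R}^{|V|}$ is the space of real-valued functions on $V$, $e$ is the constant function with value $1$, and $\langle\cdot,\cdot\rangle$ is the canonical inner product. A connected graph $G=(V,E)$ is of QE class if there is a map $\psi:V\to\mathcal{H}$ into a Euclidean space $\mathcal{H}$ with $d(i,j)=\|\psi(i)-\psi(j)\|^2$ for all $i,j\in V$, where $d$ is the graph distance; by Schoenberg's theorem this holds if and only if $\mathrm{QEC}(G)\le 0$. It is of non-QE class if it is not of QE class. The Cartesian product $G_1\times G_2$ of $G_1=(V_1,E_1)$ and $G_2=(V_2,E_2)$ has vertex set $V_1\times V_2$, with $(u,v)$ and $(u',v')$ adjacent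 if and only if either $u\sim u'$ in $G_1$ and $v=v'$, or $u=u'$ and $v\sim v'$ in $G_2$. *)

theory Defs
  imports "HOL-Analysis.Analysis" "Graph_Theory.Graph_Theory"
begin

text \<open>
  Finite simple graphs are the \<open>pair_graph\<close>s of Graph\_Theory, i.e. finite symmetric loop-free
  digraphs without parallel arcs.
\<close>

text \<open>
  \<open>\<mu>\<close> is the infimum over all walks of the total arc weight; with unit weights it is the length
  of a shortest path, and it is finite if \<open>u\<close> and \<open>v\<close> are connected.
\<close>

definition graph_dist :: "'a pair_pre_digraph \<Rightarrow> 'a \<Rightarrow> 'a \<Rightarrow> real" where
  "graph_dist G u v = real_of_ereal (wf_digraph.\<mu> (with_proj G) (\<lambda>_. 1) u v)"

definition dist_quad_form :: "'a pair_pre_digraph \<Rightarrow> ('a \<Rightarrow> real) \<Rightarrow> real" where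
  "dist_quad_form G f = (\<Sum>v\<in>pverts G. f v * (\<Sum>w\<in>pverts G. graph_dist G v w * f w))"

text \<open>Only the restriction of \<open>f\<close> to the vertex set matters.\<close>

definition qec_admissible :: "'a pair_pre_digraph \<Rightarrow> ('a \<Rightarrow> real) \<Rightarrow> bool" where
  "qec_admissible G f \<longleftrightarrow> (\<Sum>v\<in>pverts G. f v * f v) = 1 \<and> (\<Sum>v\<in>pverts G. f v) = 0"

text \<open>
  On a one-vertex graph no function is admissible and the maximum is undefined; we set the constant
  to \<open>0\<close> there. For at least two vertices the maximum exists, see \<open>QEC_is_maximum\<close> below.
\<close>

definition QEC :: "'a pair_pre_digraph \<Rightarrow> real" where
  "QEC G = (if card (pverts G) = 1 then 0
            else (GREATEST q. \<exists>f. qec_admissible G f \<and> q = dist_quad_form G f))"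

text \<open>The Euclidean space is \<open>\<real>\<^sup>N\<close>, with points given by their coordinates \<open>\<psi> v k\<close>, \<open>k < N\<close>.\<close>

definition QE_class :: "'a pair_pre_digraph \<Rightarrow> bool" where
  "QE_class G \<longleftrightarrow> (\<exists>(N::nat) (\<psi> :: 'a \<Rightarrow> nat \<Rightarrow> real).
     \<forall>i\<in>pverts G. \<forall>j\<in>pverts G. graph_dist G i j = (\<Sum>k<N. (\<psi> i k - \<psi> j k)\<^sup>2))"

definition cartesian_product ::
  "'a pair_pre_digraph \<Rightarrow> 'b pair_pre_digraph \<Rightarrow> ('a \<times> 'b) pair_pre_digraph" where
  "cartesian_product G H =
     \<lparr> pverts = pverts G \<times> pverts H,
       parcs = {((u, v), (u', v')) | u v u' v'.
                  ((u, u') \<in> parcs G \<and> v = v' \<and> v \<in> pverts H)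
                \<or> (u = u' \<and> u \<in> pverts G \<and> (v, v') \<in> parcs H)} \<rparr>"

lemma QEC_is_maximum:
  fixes G :: "'a pair_pre_digraph"
  assumes fin: "finite (pverts G)" and card: "card (pverts G) \<ge> 2"
  shows "\<exists>f. qec_admissible G f \<and> QEC G = dist_quad_form G f"
    and "qec_admissible G g \<Longrightarrow> dist_quad_form G g \<le> QEC G"
proof -
  let ?V = "pverts G"
  define B where "B = PiE UNIV (\<lambda>v. if v \<in> ?V then {-1..1} else {0::real})"
  define S where "S = B \<inter> {f. (\<Sum>v\<in>?V. f v * f v) = 1} \<inter> {f. (\<Sum>v\<in>?V. f v) = 0}"
  have coord: "continuous_on UNIV (\<lambda>f::'a \<Rightarrow> real. f v)" for v
    by (rule continuous_on_product_coordinates)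
  have "compact B"
  proof -
    have "compactin (product_topology (\<lambda>i. euclidean) UNIV) B"
      unfolding B_def by (subst compactin_PiE) auto
    then show ?thesis by (simp add: euclidean_product_topology)
  qed
  moreover have "closed {f. (\<Sum>v\<in>?V. f v * f v) = (1::real)}"
    by (intro closed_Collect_eq continuous_intros coord)
  moreover have "closed {f. (\<Sum>v\<in>?V. f v) = (0::real)}"
    by (intro closed_Collect_eq continuous_intros coord)
  ultimately have "compact S"
    unfolding S_def by (intro compact_Int_closed)
  have cont: "continuous_on S (dist_quad_form G)"
    unfolding dist_quad_form_def
    by (intro continuous_intros continuous_on_subset[OF coord]) auto
  have restrict_in_S: "\<exists>f'\<in>S. dist_quad_form G f' = dist_quad_form G f" if "qec_admissible G f" for f
  proof
    let ?f = "\<lambda>v. if v \<in> ?V then f v else 0"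
    have "f v \<in> {-1..1}" if "v \<in> ?V" for v
    proof -
      have "f v * f v \<le> 1"
        using member_le_sum[OF that, of "\<lambda>v. f v * f v"] fin \<open>qec_admissible G f\<close>
        by (simp add: qec_admissible_def)
      then show ?thesis
        using abs_le_square_iff[of "f v" 1] by (auto simp: power2_eq_square)
    qed
    then show "?f \<in> S"
      using that by (auto simp: S_def B_def qec_admissible_def)
    show "dist_quad_form G ?f = dist_quad_form G f"
      by (simp add: dist_quad_form_def)
  qed
  have S_admissible: "qec_admissible G f" if "f \<in> S" for f
    using that by (simp add: S_def qec_admissible_def)
  obtain a b where ab: "a \<in> ?V" "b \<in> ?V" "a \<noteq> b"
    using card by (metis One_nat_def Suc_1 card_le_Suc0_iff_eq fin not_less_eq_eq)
  define h where "h = (\<lambda>v. if v = a then 1 / sqrt 2 else if v = b then - (1 / sqrt 2) else 0)"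
  have "qec_admissible G h"
  proof -
    have "sum h ?V = sum h {a, b}" "(\<Sum>v\<in>?V. h v * h v) = (\<Sum>v\<in>{a, b}. h v * h v)"
      by (rule sum.mono_neutral_right; use ab fin in \<open>auto simp: h_def\<close>)+
    then show ?thesis using ab by (simp add: qec_admissible_def h_def)
  qed
  then have "S \<noteq> {}" using restrict_in_S by blast
  then obtain f where f: "f \<in> S" "\<And>g. g \<in> S \<Longrightarrow> dist_quad_form G g \<le> dist_quad_form G f"
    using continuous_attains_sup[OF \<open>compact S\<close> _ cont] by blast
  have max: "dist_quad_form G g \<le> dist_quad_form G f" if "qec_admissible G g" for g
    using restrict_in_S[OF that] f(2) by metis
  have "QEC G = dist_quad_form G f"
    unfolding QEC_def using card f(1) S_admissible max by (auto intro!: Greatest_equality)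
  then show "\<exists>f. qec_admissible G f \<and> QEC G = dist_quad_form G f"
    and "qec_admissible G g \<Longrightarrow> dist_quad_form G g \<le> QEC G"
    using f(1) S_admissible max by auto
qed

end

theory Submission
  imports Defs
begin

text \<open>
  Distances in a Cartesian product add up, so the distance matrix of \<open>G \<times> H\<close> is
  \<open>D\<^sub>G \<otimes> J + J \<otimes> D\<^sub>H\<close>, where \<open>J\<close> is an all-ones matrix. Its quadratic form therefore sees a
  function \<open>f\<close> on \<open>V(G) \<times> V(H)\<close> only through its two marginals, that is, its row sums \<open>a\<close> on
  \<open>V(G)\<close> and its column sums \<open>b\<close> on \<open>V(H)\<close>; it equals \<open>\<langle>a, D\<^sub>G a\<rangle> + \<langle>b, D\<^sub>H b\<rangle>\<close>
  (\<open>dist_quad_form_cartesian_product\<close>). If \<open>f\<close> sums to zero, so do \<open>a\<close> and \<open>b\<close>. Then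
  \<open>a \<otimes> e / |V(H)|\<close> and \<open>e \<otimes> b / |V(G)|\<close> are orthogonal, their sum is the orthogonal projection of \<open>f\<close>
  onto the functions of the form \<open>\<alpha>(u) + \<beta>(v)\<close>, and Bessel's inequality reads
  \<open>|a|\<^sup>2 / |V(H)| + |b|\<^sup>2 / |V(G)| \<le> |f|\<^sup>2\<close> (\<open>marginals_bessel\<close>). Hence
  \<open>QEC (G \<times> H) = max (|V(H)| QEC G) (|V(G)| QEC H)\<close> as soon as one of the two constants is positive;
  without positivity a function with vanishing marginals, for which the form is \<open>0\<close>, could
  do better.

  For \<open>K = K\<^sub>m\<^sub>,\<^sub>n\<close> and \<open>f\<close> with sum zero the quadratic form is \<open>2 A\<^sup>2 - 2 |f|\<^sup>2\<close>, where \<open>A\<close> is the sum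
  of \<open>f\<close> over one part. By Cauchy-Schwarz \<open>A\<^sup>2 (1/m + 1/n) \<le> |f|\<^sup>2\<close>, with equality for functions that
  are constant on each part, which yields \<open>QEC K = 2mn/(m+n) - 2\<close>
  (\<open>QEC_complete_bipartite\<close>).

  What remains is Schoenberg's theorem \<open>QE_class G \<longleftrightarrow> QEC G \<le> 0\<close>. Its nontrivial half takes a base
  point \<open>o\<close> and writes the matrix \<open>(d(i,o) + d(j,o) - d(i,j)) / 2\<close>, which is then positive
  semidefinite, as a Gram matrix.
\<close>

section \<open>Graph distance as the least length of a walk\<close>

lemma (in pair_wf_digraph) awalk_length_iff_relpow:
  "(\<exists>p. awalk u p v \<and> length p = k) \<longleftrightarrow> u \<in> pverts G \<and> (u, v) \<in> parcs G ^^ k"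
proof (induction k arbitrary: u)
  case 0
  show ?case by (auto simp: awalk_Nil_iff)
next
  case (Suc k)
  have "(\<exists>p. awalk u p v \<and> length p = Suc k)
      \<longleftrightarrow> (\<exists>w. (u, w) \<in> parcs G \<and> (\<exists>p. awalk w p v \<and> length p = k))"
  proof
    assume "\<exists>p. awalk u p v \<and> length p = Suc k"
    then obtain e p where "awalk u (e # p) v" "length p = k"
      by (metis length_Suc_conv)
    then show "\<exists>w. (u, w) \<in> parcs G \<and> (\<exists>p. awalk w p v \<and> length p = k)"
      by (cases e) (auto simp: awalk_Cons_iff)
  next
    assume "\<exists>w. (u, w) \<in> parcs G \<and> (\<exists>p. awalk w p v \<and> length p = k)"
    then obtain w p where "(u, w) \<in> parcs G" "awalk w p v" "length p = k"
      by blast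
    then have "awalk u ((u, w) # p) v" "length ((u, w) # p) = Suc k"
      by (auto simp: awalk_Cons_iff)
    then show "\<exists>p. awalk u p v \<and> length p = Suc k" by blast
  qed
  also have "\<dots> \<longleftrightarrow> (\<exists>w. (u, w) \<in> parcs G \<and> (w, v) \<in> parcs G ^^ k)"
    unfolding Suc.IH using in_arcsD2 by blast
  also have "\<dots> \<longleftrightarrow> u \<in> pverts G \<and> (u, v) \<in> parcs G ^^ Suc k"
    by (meson in_arcsD1 relpow_Suc_D2 relpow_Suc_I2)
  finally show ?case .
qed

lemma graph_dist_eqI:
  assumes "pair_wf_digraph G" and "u \<in> pverts G"
    and walk: "(u, v) \<in> parcs G ^^ k" and least: "\<And>j. (u, v) \<in> parcs G ^^ j \<Longrightarrow> k \<le> j"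
  shows "graph_dist G u v = real k"
proof -
  interpret pair_wf_digraph G by fact
  have cost: "awalk_cost (\<lambda>_. 1) p = real (length p)" for p :: "('a \<times> 'a) list"
    by (induction p) auto
  have "(INF p\<in>{p. awalk u p v}. ereal (awalk_cost (\<lambda>_. 1) p)) = ereal (real k)"
  proof (rule INF_eqI)
    fix p assume "p \<in> {p. awalk u p v}"
    then have "(u, v) \<in> parcs G ^^ length p"
      using awalk_length_iff_relpow by blast
    then show "ereal (real k) \<le> ereal (awalk_cost (\<lambda>_. 1) p)"
      by (simp add: cost least)
  next
    fix y assume "\<And>p. p \<in> {p. awalk u p v} \<Longrightarrow> y \<le> ereal (awalk_cost (\<lambda>_. 1) p)"
    moreover obtain p where "awalk u p v" "length p = k"
      using awalk_length_iff_relpow assms(2) walk by blast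
    ultimately show "y \<le> ereal (real k)"
      by (metis cost mem_Collect_eq)
  qed
  then show ?thesis by (simp add: graph_dist_def \<mu>_def)
qed

lemma connected_iff_reachable:
  assumes "pair_graph G"
  shows "Digraph_Component.connected (with_proj G) \<longleftrightarrow>
    pverts G \<noteq> {} \<and> (\<forall>u\<in>pverts G. \<forall>v\<in>pverts G. u \<rightarrow>\<^sup>*\<^bsub>with_proj G\<^esub> v)"
proof -
  interpret pair_graph G by fact
  have "symmetric (with_proj G)" by (rule pair_sym_arcs)
  from reachable_mk_symmetric_eq[OF this] show ?thesis
    by (simp add: Digraph_Component.connected_def strongly_connected_def mk_symmetric_def)
qed

lemma ex_shortest_walk:
  assumes "pair_graph G" and "Digraph_Component.connected (with_proj G)"
    and "u \<in> pverts G" and "v \<in> pverts G"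
  shows "\<exists>k. graph_dist G u v = real k \<and> (u, v) \<in> parcs G ^^ k
    \<and> (\<forall>j. (u, v) \<in> parcs G ^^ j \<longrightarrow> k \<le> j)"
proof -
  interpret pair_graph G by fact
  have "u \<rightarrow>\<^sup>*\<^bsub>with_proj G\<^esub> v"
    using assms connected_iff_reachable by blast
  then have "(u, v) \<in> (parcs G)\<^sup>*"
    by (auto dest: reachable_rtranclI)
  then obtain j where j: "(u, v) \<in> parcs G ^^ j"
    by (auto dest: rtrancl_imp_relpow)
  define k where "k = (LEAST k. (u, v) \<in> parcs G ^^ k)"
  have k: "(u, v) \<in> parcs G ^^ k"
    unfolding k_def using j by (rule LeastI)
  moreover have least: "\<And>j. (u, v) \<in> parcs G ^^ j \<Longrightarrow> k \<le> j"
    unfolding k_def by (rule Least_le)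
  moreover have "graph_dist G u v = real k"
    by (rule graph_dist_eqI) (use assms k least pair_wf_digraph in auto)
  ultimately show ?thesis by blast
qed

lemma graph_dist_self:
  assumes "pair_wf_digraph G" and "v \<in> pverts G"
  shows "graph_dist G v v = 0"
  using graph_dist_eqI[OF assms, of v 0] by simp

lemma graph_dist_commute:
  assumes "pair_graph G" and "Digraph_Component.connected (with_proj G)"
    and "u \<in> pverts G" and "v \<in> pverts G"
  shows "graph_dist G u v = graph_dist G v u"
proof -
  interpret pair_graph G by fact
  have rev: "(y, x) \<in> parcs G ^^ k" if "(x, y) \<in> parcs G ^^ k" for x y k
    using that
  proof (induction k arbitrary: y)
    case (Suc k)
    then obtain z where "(x, z) \<in> parcs G ^^ k" "(z, y) \<in> parcs G" by auto
    with Suc.IH[of z] arcs_symmetric show ?case by (blast intro: relpow_Suc_I2)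
  qed simp
  obtain k where k: "graph_dist G u v = real k" "(u, v) \<in> parcs G ^^ k"
    "\<And>j. (u, v) \<in> parcs G ^^ j \<Longrightarrow> k \<le> j"
    using ex_shortest_walk[OF assms] by blast
  have "graph_dist G v u = real k"
    by (rule graph_dist_eqI) (use assms rev k pair_wf_digraph in blast)+
  then show ?thesis using k(1) by simp
qed

section \<open>Distances in Cartesian products\<close>

lemma pverts_cartesian_product [simp]:
  "pverts (cartesian_product G H) = pverts G \<times> pverts H"
  by (simp add: cartesian_product_def)

lemma pair_wf_digraph_cartesian_product:
  assumes "pair_wf_digraph G" and "pair_wf_digraph H"
  shows "pair_wf_digraph (cartesian_product G H)"
proof -
  interpret G: pair_wf_digraph G by fact
  interpret H: pair_wf_digraph H by fact
  show ?thesis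
    by unfold_locales
      (auto simp: cartesian_product_def dest: G.in_arcsD1 G.in_arcsD2 H.in_arcsD1 H.in_arcsD2)
qed

text \<open>
  Each step of a walk in the product moves exactly one coordinate, so a walk projects to a walk in each
  factor and the lengths add up; conversely one may first walk in one factor and then in the other.
\<close>
lemma relpow_cartesian_product:
  assumes "pair_wf_digraph G" and "pair_wf_digraph H" and "u \<in> pverts G" and "v \<in> pverts H"
  shows "((u, v), (u', v')) \<in> parcs (cartesian_product G H) ^^ k \<longleftrightarrow>
    (\<exists>i j. k = i + j \<and> (u, u') \<in> parcs G ^^ i \<and> (v, v') \<in> parcs H ^^ j)"
proof
  interpret G: pair_wf_digraph G by fact
  interpret H: pair_wf_digraph H by fact
  let ?P = "parcs (cartesian_product G H)"
  show "\<exists>i j. k = i + j \<and> (u, u') \<in> parcs G ^^ i \<and> (v, v') \<in> parcs H ^^ j"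
    if "((u, v), (u', v')) \<in> ?P ^^ k"
    using that
  proof (induction k arbitrary: u' v')
    case 0
    then show ?case by auto
  next
    case (Suc k)
    then obtain u1 v1 where step: "((u, v), (u1, v1)) \<in> ?P ^^ k" "((u1, v1), (u', v')) \<in> ?P"
      by auto
    obtain i j where ij: "k = i + j" "(u, u1) \<in> parcs G ^^ i" "(v, v1) \<in> parcs H ^^ j"
      using Suc.IH step(1) by blast
    consider "(u1, u') \<in> parcs G" "v1 = v'" | "u1 = u'" "(v1, v') \<in> parcs H"
      using step(2) by (auto simp: cartesian_product_def)
    then show ?case
    proof cases
      case 1
      then have "(u, u') \<in> parcs G ^^ Suc i" using ij(2) by (blast intro: relpow_Suc_I)
      then show ?thesis using ij 1 by (metis add_Suc)
    next
      case 2
      then have "(v, v') \<in> parcs H ^^ Suc j" using ij(3) by (blast intro: relpow_Suc_I)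
      then show ?thesis using ij 2 by (metis add_Suc_right)
    qed
  qed
  have left: "((u, v), (u', v)) \<in> ?P ^^ i" if "(u, u') \<in> parcs G ^^ i" for i
    using that
  proof (induction i arbitrary: u')
    case (Suc i)
    then obtain w where "(u, w) \<in> parcs G ^^ i" "(w, u') \<in> parcs G" by auto
    moreover have "((w, v), (u', v)) \<in> ?P"
      using \<open>(w, u') \<in> parcs G\<close> assms(4) by (auto simp: cartesian_product_def)
    ultimately show ?case using Suc.IH by (blast intro: relpow_Suc_I)
  qed simp
  have right: "((u', v), (u', v')) \<in> ?P ^^ j" if "(v, v') \<in> parcs H ^^ j" "u' \<in> pverts G" for j
    using that(1)
  proof (induction j arbitrary: v')
    case (Suc j)
    then obtain w where "(v, w) \<in> parcs H ^^ j" "(w, v') \<in> parcs H" by auto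
    moreover have "((u', w), (u', v')) \<in> ?P"
      using \<open>(w, v') \<in> parcs H\<close> that(2) by (auto simp: cartesian_product_def)
    ultimately show ?case using Suc.IH by (blast intro: relpow_Suc_I)
  qed simp
  assume "\<exists>i j. k = i + j \<and> (u, u') \<in> parcs G ^^ i \<and> (v, v') \<in> parcs H ^^ j"
  then obtain i j where ij: "k = i + j" "(u, u') \<in> parcs G ^^ i" "(v, v') \<in> parcs H ^^ j"
    by blast
  have "u' \<in> pverts G"
    using ij(2) assms(3) by (cases i) (auto dest: G.in_arcsD2)
  then show "((u, v), (u', v')) \<in> ?P ^^ k"
    using left[OF ij(2)] right[OF ij(3)] ij(1) by (blast intro: relpow_trans)
qed

lemma graph_dist_cartesian_product:
  assumes "pair_graph G" and "Digraph_Component.connected (with_proj G)"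
    and "pair_graph H" and "Digraph_Component.connected (with_proj H)"
    and "u \<in> pverts G" "u' \<in> pverts G" "v \<in> pverts H" "v' \<in> pverts H"
  shows "graph_dist (cartesian_product G H) (u, v) (u', v') = graph_dist G u u' + graph_dist H v v'"
proof -
  interpret G: pair_graph G by fact
  interpret H: pair_graph H by fact
  obtain i where i: "graph_dist G u u' = real i" "(u, u') \<in> parcs G ^^ i"
    "\<And>j. (u, u') \<in> parcs G ^^ j \<Longrightarrow> i \<le> j"
    using ex_shortest_walk[OF assms(1,2,5,6)] by blast
  obtain j where j: "graph_dist H v v' = real j" "(v, v') \<in> parcs H ^^ j"
    "\<And>k. (v, v') \<in> parcs H ^^ k \<Longrightarrow> j \<le> k"
    using ex_shortest_walk[OF assms(3,4,7,8)] by blast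
  note relpow = relpow_cartesian_product[OF G.pair_wf_digraph H.pair_wf_digraph assms(5,7)]
  have "graph_dist (cartesian_product G H) (u, v) (u', v') = real (i + j)"
  proof (rule graph_dist_eqI)
    show "pair_wf_digraph (cartesian_product G H)"
      by (intro pair_wf_digraph_cartesian_product G.pair_wf_digraph H.pair_wf_digraph)
    show "((u, v), (u', v')) \<in> parcs (cartesian_product G H) ^^ (i + j)"
      unfolding relpow using i j by blast
    show "i + j \<le> k" if "((u, v), (u', v')) \<in> parcs (cartesian_product G H) ^^ k" for k
      using that i(3) j(3) unfolding relpow by (auto intro: add_mono)
  qed (use assms in simp)
  then show ?thesis using i j by simp
qed

section \<open>The quadratic embedding constant of a Cartesian product\<close>

text \<open>
  The homogeneous form of the maximum property. It includes one-vertex graphs, where the only function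
  with sum zero vanishes and the value \<open>QEC G = 0\<close> makes the bound an equality.
\<close>
lemma dist_quad_form_le_QEC:
  assumes fin: "finite (pverts G)" and "pverts G \<noteq> {}" and sum0: "(\<Sum>v\<in>pverts G. f v) = 0"
  shows "dist_quad_form G f \<le> QEC G * (\<Sum>v\<in>pverts G. (f v)\<^sup>2)"
proof (cases "\<forall>v\<in>pverts G. f v = 0")
  case True
  then show ?thesis by (simp add: dist_quad_form_def)
next
  case False
  define s where "s = (\<Sum>v\<in>pverts G. (f v)\<^sup>2)"
  have "s > 0"
    using False fin by (auto simp: s_def intro!: sum_pos2)
  have "card (pverts G) \<noteq> 1"
    using False sum0 by (auto simp: card_1_singleton_iff)
  moreover have "card (pverts G) \<noteq> 0" using assms by simp
  ultimately have card: "card (pverts G) \<ge> 2" by linarith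
  let ?g = "\<lambda>v. f v / sqrt s"
  have sq: "a / sqrt s * (b / sqrt s) = a * b / s" for a b
    using \<open>s > 0\<close> by simp
  have "qec_admissible G ?g"
    using \<open>s > 0\<close> sum0 unfolding qec_admissible_def sq
    by (simp add: s_def power2_eq_square flip: sum_divide_distrib)
  then have "dist_quad_form G ?g \<le> QEC G"
    using QEC_is_maximum(2)[OF fin card] by blast
  moreover have "dist_quad_form G ?g = dist_quad_form G f / s"
  proof -
    have "dist_quad_form G ?g = (\<Sum>v\<in>pverts G. \<Sum>w\<in>pverts G. graph_dist G v w * (?g v * ?g w))"
      by (simp add: dist_quad_form_def sum_distrib_left mult_ac)
    also have "\<dots> = (\<Sum>v\<in>pverts G. \<Sum>w\<in>pverts G. graph_dist G v w * (f v * f w)) / s"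
      unfolding sq by (simp only: sum_divide_distrib times_divide_eq_right)
    also have "\<dots> = dist_quad_form G f / s"
      by (simp add: dist_quad_form_def sum_distrib_left mult_ac)
    finally show ?thesis .
  qed
  ultimately show ?thesis
    using \<open>s > 0\<close> by (simp add: field_simps s_def)
qed

lemma QEC_eqI:
  assumes "finite (pverts G)" and "card (pverts G) \<ge> 2"
    and "qec_admissible G f" and "q \<le> dist_quad_form G f"
    and "\<And>g. qec_admissible G g \<Longrightarrow> dist_quad_form G g \<le> q"
  shows "QEC G = q"
  using QEC_is_maximum[OF assms(1,2)] assms(3-5) by (metis order.antisym order.trans)

lemma dist_quad_form_cartesian_product:
  assumes "pair_graph G" and "Digraph_Component.connected (with_proj G)"
    and "pair_graph H" and "Digraph_Component.connected (with_proj H)"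
  shows "dist_quad_form (cartesian_product G H) f =
    dist_quad_form G (\<lambda>u. \<Sum>v\<in>pverts H. f (u, v)) + dist_quad_form H (\<lambda>v. \<Sum>u\<in>pverts G. f (u, v))"
proof -
  let ?V = "pverts G" and ?W = "pverts H"
  let ?a = "\<lambda>u. \<Sum>v\<in>?W. f (u, v)" and ?b = "\<lambda>v. \<Sum>u\<in>?V. f (u, v)"
  have inner: "(\<Sum>x\<in>?V \<times> ?W. graph_dist (cartesian_product G H) (u, v) x * f x) =
      (\<Sum>u'\<in>?V. graph_dist G u u' * ?a u') + (\<Sum>v'\<in>?W. graph_dist H v v' * ?b v')"
    if uv: "u \<in> ?V" "v \<in> ?W" for u v
  proof -
    have "(\<Sum>x\<in>?V \<times> ?W. graph_dist (cartesian_product G H) (u, v) x * f x) =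
        (\<Sum>u'\<in>?V. \<Sum>v'\<in>?W. graph_dist (cartesian_product G H) (u, v) (u', v') * f (u', v'))"
      by (simp add: sum.cartesian_product)
    also have "\<dots> = (\<Sum>u'\<in>?V. \<Sum>v'\<in>?W. graph_dist G u u' * f (u', v') + graph_dist H v v' * f (u', v'))"
      by (intro sum.cong refl) (simp add: graph_dist_cartesian_product[OF assms] uv algebra_simps)
    also have "\<dots> = (\<Sum>u'\<in>?V. \<Sum>v'\<in>?W. graph_dist G u u' * f (u', v'))
        + (\<Sum>v'\<in>?W. \<Sum>u'\<in>?V. graph_dist H v v' * f (u', v'))"
      unfolding sum.distrib by (subst (2) sum.swap) (rule refl)
    finally show ?thesis by (simp add: sum_distrib_left)
  qed
  have "dist_quad_form (cartesian_product G H) f =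
      (\<Sum>u\<in>?V. \<Sum>v\<in>?W. f (u, v) * (\<Sum>x\<in>?V \<times> ?W. graph_dist (cartesian_product G H) (u, v) x * f x))"
    by (simp add: dist_quad_form_def sum.cartesian_product)
  also have "\<dots> = (\<Sum>u\<in>?V. \<Sum>v\<in>?W. f (u, v) * (\<Sum>u'\<in>?V. graph_dist G u u' * ?a u')
      + f (u, v) * (\<Sum>v'\<in>?W. graph_dist H v v' * ?b v'))"
    by (intro sum.cong refl) (simp add: inner distrib_left)
  also have "\<dots> = (\<Sum>u\<in>?V. \<Sum>v\<in>?W. f (u, v) * (\<Sum>u'\<in>?V. graph_dist G u u' * ?a u'))
      + (\<Sum>v\<in>?W. \<Sum>u\<in>?V. f (u, v) * (\<Sum>v'\<in>?W. graph_dist H v v' * ?b v'))"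
    unfolding sum.distrib by (subst (2) sum.swap) (rule refl)
  finally show ?thesis
    by (simp add: dist_quad_form_def sum_distrib_right)
qed

lemma marginals_bessel:
  fixes f :: "'a \<times> 'b \<Rightarrow> real"
  assumes "finite V" "V \<noteq> {}" "finite W" "W \<noteq> {}" and sum0: "sum f (V \<times> W) = 0"
  shows "(\<Sum>u\<in>V. (\<Sum>v\<in>W. f (u, v))\<^sup>2) / card W + (\<Sum>v\<in>W. (\<Sum>u\<in>V. f (u, v))\<^sup>2) / card V
    \<le> (\<Sum>x\<in>V \<times> W. (f x)\<^sup>2)"
proof -
  let ?a = "\<lambda>u. \<Sum>v\<in>W. f (u, v)" and ?b = "\<lambda>v. \<Sum>u\<in>V. f (u, v)"
  define g h where "g = real (card V)" and "h = real (card W)"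
  have pos: "g > 0" "h > 0" using assms by (simp_all add: g_def h_def card_gt_0_iff)
  have a0: "(\<Sum>u\<in>V. ?a u) = 0"
    using sum0 by (simp add: sum.cartesian_product)
  have b0: "(\<Sum>v\<in>W. ?b v) = 0"
    using a0 by (subst sum.swap)
  have fa: "(\<Sum>u\<in>V. \<Sum>v\<in>W. f (u, v) * ?a u) = (\<Sum>u\<in>V. (?a u)\<^sup>2)"
    by (simp add: power2_eq_square flip: sum_distrib_right)
  have fb: "(\<Sum>u\<in>V. \<Sum>v\<in>W. f (u, v) * ?b v) = (\<Sum>v\<in>W. (?b v)\<^sup>2)"
    by (subst sum.swap) (simp add: power2_eq_square flip: sum_distrib_right)
  have ab: "(\<Sum>u\<in>V. \<Sum>v\<in>W. ?a u * ?b v) = 0"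
    by (simp only: sum_distrib_left[symmetric] b0) simp
  (* the squared norm of the component of f orthogonal to the functions \<alpha>(u) + \<beta>(v) *)
  have "0 \<le> (\<Sum>u\<in>V. \<Sum>v\<in>W. (f (u, v) - ?a u / h - ?b v / g)\<^sup>2)"
    by (intro sum_nonneg) simp
  also have "\<dots> = (\<Sum>u\<in>V. \<Sum>v\<in>W. (f (u, v))\<^sup>2 + (?a u)\<^sup>2 / h\<^sup>2 + (?b v)\<^sup>2 / g\<^sup>2
      - 2 / h * (f (u, v) * ?a u) - 2 / g * (f (u, v) * ?b v) + 2 / (g * h) * (?a u * ?b v))"
    using pos by (intro sum.cong refl) (simp add: power2_eq_square field_simps)
  also have "\<dots> = (\<Sum>u\<in>V. \<Sum>v\<in>W. (f (u, v))\<^sup>2) + h * ((\<Sum>u\<in>V. (?a u)\<^sup>2) / h\<^sup>2)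
      + g * ((\<Sum>v\<in>W. (?b v)\<^sup>2) / g\<^sup>2) - 2 / h * (\<Sum>u\<in>V. (?a u)\<^sup>2) - 2 / g * (\<Sum>v\<in>W. (?b v)\<^sup>2)"
    unfolding sum.distrib sum_subtractf sum_distrib_left[symmetric] fa fb
    using ab by (simp add: g_def h_def sum_divide_distrib sum_distrib_left)
  also have "\<dots> = (\<Sum>u\<in>V. \<Sum>v\<in>W. (f (u, v))\<^sup>2)
      - (\<Sum>u\<in>V. (?a u)\<^sup>2) / h - (\<Sum>v\<in>W. (?b v)\<^sup>2) / g"
    using pos by (simp add: power2_eq_square)
  finally show ?thesis
    by (simp add: g_def h_def sum.cartesian_product)
qed

text \<open>
  A maximiser on a factor, spread evenly over the fibres of the product, shows that each of the two
  values in the maximum is attained.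
\<close>
lemma QEC_cartesian_product_witness_left:
  assumes "pair_graph G" and "Digraph_Component.connected (with_proj G)"
    and "pair_graph H" and "Digraph_Component.connected (with_proj H)"
    and "card (pverts G) \<ge> 2"
  shows "\<exists>f. qec_admissible (cartesian_product G H) f
    \<and> dist_quad_form (cartesian_product G H) f = card (pverts H) * QEC G"
proof -
  have fin: "finite (pverts G)" "finite (pverts H)"
    using assms pair_fin_digraph.pair_finite_verts pair_graph.axioms(1) pair_digraph.axioms(1) by blast+
  define h where "h = real (card (pverts H))"
  have "h > 0"
    using assms connected_iff_reachable fin by (auto simp: h_def card_gt_0_iff)
  obtain a where a: "qec_admissible G a" "QEC G = dist_quad_form G a"
    using QEC_is_maximum(1)[OF fin(1) assms(5)] by blast
  let ?f = "\<lambda>x::'a \<times> 'b. a (fst x) / sqrt h"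
  have "(\<Sum>x\<in>pverts G \<times> pverts H. ?f x * ?f x) = (\<Sum>u\<in>pverts G. \<Sum>v\<in>pverts H. a u * a u / h)"
    unfolding sum.cartesian_product using \<open>h > 0\<close> by (intro sum.cong) auto
  also have "\<dots> = 1"
    using \<open>h > 0\<close> a(1) by (simp add: qec_admissible_def flip: h_def)
  finally have norm: "(\<Sum>x\<in>pverts G \<times> pverts H. ?f x * ?f x) = 1" .
  have a0: "(\<Sum>u\<in>pverts G. a u / sqrt h) = 0"
    using a(1) by (simp add: qec_admissible_def flip: sum_divide_distrib)
  have "(\<Sum>x\<in>pverts G \<times> pverts H. ?f x) = (\<Sum>v\<in>pverts H. \<Sum>u\<in>pverts G. a u / sqrt h)"
    by (subst sum.swap) (unfold sum.cartesian_product, intro sum.cong, auto)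
  then have adm: "qec_admissible (cartesian_product G H) ?f"
    using norm a0 by (simp add: qec_admissible_def)
  have "h * (x / sqrt h) = sqrt h * x" for x
    using \<open>h > 0\<close> by (simp add: real_div_sqrt field_simps)
  then have "dist_quad_form (cartesian_product G H) ?f = dist_quad_form G (\<lambda>u. sqrt h * a u)"
    unfolding dist_quad_form_cartesian_product[OF assms(1-4)]
    using a0 by (simp add: dist_quad_form_def flip: h_def)
  also have "\<dots> = (\<Sum>u\<in>pverts G. \<Sum>w\<in>pverts G. (sqrt h * sqrt h) * (a u * (graph_dist G u w * a w)))"
    unfolding dist_quad_form_def sum_distrib_left by (simp only: mult_ac)
  also have "\<dots> = h * QEC G"
    using \<open>h > 0\<close> a(2) by (simp add: dist_quad_form_def sum_distrib_left)
  finally show ?thesis using adm h_def by blast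
qed

lemma QEC_cartesian_product_witness_right:
  assumes "pair_graph G" and "Digraph_Component.connected (with_proj G)"
    and "pair_graph H" and "Digraph_Component.connected (with_proj H)"
    and "card (pverts H) \<ge> 2"
  shows "\<exists>f. qec_admissible (cartesian_product G H) f
    \<and> dist_quad_form (cartesian_product G H) f = card (pverts G) * QEC H"
proof -
  obtain f where f: "qec_admissible (cartesian_product H G) f"
    "dist_quad_form (cartesian_product H G) f = card (pverts G) * QEC H"
    using QEC_cartesian_product_witness_left[OF assms(3,4,1,2,5)] by blast
  have swap: "(\<Sum>x\<in>pverts G \<times> pverts H. F (prod.swap x)) = (\<Sum>x\<in>pverts H \<times> pverts G. F x)"
    for F :: "'b \<times> 'a \<Rightarrow> real"
    by (rule sum.reindex_bij_witness[of _ prod.swap prod.swap]) auto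
  have "qec_admissible (cartesian_product G H) (f \<circ> prod.swap)"
    using f(1) swap[of f] swap[of "\<lambda>x. f x * f x"] by (simp add: qec_admissible_def)
  moreover have "dist_quad_form (cartesian_product G H) (f \<circ> prod.swap) = card (pverts G) * QEC H"
    using f(2) by (simp add: dist_quad_form_cartesian_product assms)
  ultimately show ?thesis by blast
qed

theorem QEC_cartesian_product:
  assumes "pair_graph G" and "Digraph_Component.connected (with_proj G)"
    and "pair_graph H" and "Digraph_Component.connected (with_proj H)"
    and pos: "0 < QEC G \<or> 0 < QEC H"
  shows "QEC (cartesian_product G H) = max (card (pverts H) * QEC G) (card (pverts G) * QEC H)"
    (is "_ = max ?p ?q")
proof -
  let ?V = "pverts G" and ?W = "pverts H"
  have fin: "finite ?V" "finite ?W"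
    using assms pair_fin_digraph.pair_finite_verts pair_graph.axioms(1) pair_digraph.axioms(1) by blast+
  have ne: "?V \<noteq> {}" "?W \<noteq> {}"
    using assms connected_iff_reachable by blast+
  have card: "card ?V > 0" "card ?W > 0"
    using fin ne by (simp_all add: card_gt_0_iff)
  have max_pos: "0 < max ?p ?q"
    using pos card by (auto simp: less_max_iff_disj)
  have card2: "card ?V \<ge> 2" if "QEC G > 0"
    using that card(1) by (cases "card ?V = 1") (auto simp: QEC_def)
  have card2': "card ?W \<ge> 2" if "QEC H > 0"
    using that card(2) by (cases "card ?W = 1") (auto simp: QEC_def)
  have "\<exists>f. qec_admissible (cartesian_product G H) f \<and>
      dist_quad_form (cartesian_product G H) f = max ?p ?q"
  proof (cases "?q \<le> ?p")
    case True
    then have "QEC G > 0" using max_pos card by (simp add: max_def zero_less_mult_iff)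
    then show ?thesis
      using QEC_cartesian_product_witness_left[OF assms(1-4) card2] True by simp
  next
    case False
    then have "QEC H > 0" using max_pos card by (simp add: max_def zero_less_mult_iff)
    then show ?thesis
      using QEC_cartesian_product_witness_right[OF assms(1-4) card2'] False by simp
  qed
  then obtain f where f: "qec_admissible (cartesian_product G H) f"
    "dist_quad_form (cartesian_product G H) f = max ?p ?q" by blast
  show ?thesis
  proof (rule QEC_eqI)
    show "finite (pverts (cartesian_product G H))" using fin by simp
    have "2 \<le> card ?V * card ?W"
      using pos card card2 card2' by (cases "QEC G > 0") (auto intro: order.trans)
    then show "card (pverts (cartesian_product G H)) \<ge> 2"
      by (simp add: card_cartesian_product)
    show "qec_admissible (cartesian_product G H) f" "max ?p ?q \<le> dist_quad_form (cartesian_product G H) f"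
      using f by simp_all
  next
    fix g assume g: "qec_admissible (cartesian_product G H) g"
    let ?a = "\<lambda>u. \<Sum>v\<in>?W. g (u, v)" and ?b = "\<lambda>v. \<Sum>u\<in>?V. g (u, v)"
    let ?A = "\<Sum>u\<in>?V. (?a u)\<^sup>2" and ?B = "\<Sum>v\<in>?W. (?b v)\<^sup>2"
    have sum0: "sum g (?V \<times> ?W) = 0" and norm: "(\<Sum>x\<in>?V \<times> ?W. (g x)\<^sup>2) = 1"
      using g by (simp_all add: qec_admissible_def power2_eq_square)
    have a0: "(\<Sum>u\<in>?V. ?a u) = 0" using sum0 by (simp add: sum.cartesian_product)
    then have b0: "(\<Sum>v\<in>?W. ?b v) = 0" by (subst sum.swap)
    have bessel: "?A / card ?W + ?B / card ?V \<le> 1"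
      using marginals_bessel[OF fin(1) ne(1) fin(2) ne(2) sum0] norm by simp
    have A0: "0 \<le> ?A / card ?W" and B0: "0 \<le> ?B / card ?V"
      by (simp_all add: sum_nonneg)
    have "dist_quad_form (cartesian_product G H) g \<le> QEC G * ?A + QEC H * ?B"
      unfolding dist_quad_form_cartesian_product[OF assms(1-4)]
      using dist_quad_form_le_QEC[OF fin(1) ne(1) a0] dist_quad_form_le_QEC[OF fin(2) ne(2) b0]
      by simp
    also have "\<dots> = ?p * (?A / card ?W) + ?q * (?B / card ?V)"
      using card by simp
    also have "\<dots> \<le> max ?p ?q * (?A / card ?W) + max ?p ?q * (?B / card ?V)"
      using A0 B0 by (intro add_mono mult_right_mono) auto
    also have "\<dots> = max ?p ?q * (?A / card ?W + ?B / card ?V)"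
      by (simp only: distrib_left)
    also have "\<dots> \<le> max ?p ?q * 1"
      using bessel max_pos by (intro mult_left_mono) auto
    finally show "dist_quad_form (cartesian_product G H) g \<le> max ?p ?q" by simp
  qed
qed

section \<open>Schoenberg's theorem\<close>

lemma sum_unit_vector:
  fixes F :: "'a \<Rightarrow> real"
  assumes "finite V" and "b \<in> V"
  shows "(\<Sum>i\<in>V. (if i = b then 1 else 0) * F i) = F b"
  using sum.delta[OF assms(1), of b F] assms(2) by (simp add: if_distrib[of "\<lambda>z. z * _"] cong: if_cong)

text \<open>
  The induction is the Cholesky decomposition. A point \<open>x\<close> is added to \<open>V\<close>; let \<open>c = M x x\<close>. If \<open>c = 0\<close>, semidefiniteness
  forces the row of \<open>x\<close> to vanish. If \<open>c > 0\<close>, one new coordinate \<open>M x i / sqrt c\<close>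
  accounts for that row, and the Schur complement \<open>M i j - M x i * M x j / c\<close> is positive
  semidefinite on \<open>V\<close>.
\<close>
lemma psd_imp_gram:
  fixes M :: "'a \<Rightarrow> 'a \<Rightarrow> real"
  assumes "finite V" and "\<And>i j. i \<in> V \<Longrightarrow> j \<in> V \<Longrightarrow> M i j = M j i"
    and "\<And>f. 0 \<le> (\<Sum>i\<in>V. \<Sum>j\<in>V. f i * f j * M i j)"
  shows "\<exists>(N::nat) \<psi>. \<forall>i\<in>V. \<forall>j\<in>V. M i j = (\<Sum>k<N. \<psi> i k * \<psi> j k)"
  using assms
proof (induction V arbitrary: M rule: finite_induct)
  case empty
  then show ?case by simp
next
  case (insert x V)
  note sym = insert.prems(1) and psd = insert.prems(2)
  let ?c = "M x x"
  have split: "(\<Sum>i\<in>insert x V. \<Sum>j\<in>insert x V. f i * f j * M i j) =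
      f x * f x * ?c + 2 * f x * (\<Sum>j\<in>V. f j * M x j) + (\<Sum>i\<in>V. \<Sum>j\<in>V. f i * f j * M i j)" for f
  proof -
    have "(\<Sum>i\<in>V. f i * f x * M i x) = f x * (\<Sum>j\<in>V. f j * M x j)"
      unfolding sum_distrib_left by (intro sum.cong refl) (use sym in auto)
    moreover have "(\<Sum>j\<in>V. f x * f j * M x j) = f x * (\<Sum>j\<in>V. f j * M x j)"
      unfolding sum_distrib_left by (simp add: mult_ac)
    ultimately show ?thesis
      using insert.hyps by (simp add: sum.distrib)
  qed
  have quad: "0 \<le> t * t * ?c + 2 * t * (\<Sum>j\<in>V. f j * M x j) + (\<Sum>i\<in>V. \<Sum>j\<in>V. f i * f j * M i j)"
    for t f
  proof -
    have "(\<Sum>i\<in>V. F ((f(x := t)) i) i) = (\<Sum>i\<in>V. F (f i) i)" for F :: "real \<Rightarrow> 'a \<Rightarrow> real"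
      using insert.hyps by (intro sum.cong) auto
    from this[of "\<lambda>y j. y * M x j"] this[of "\<lambda>y i. \<Sum>j\<in>V. y * f j * M i j"]
    have "(\<Sum>j\<in>V. (f(x := t)) j * M x j) = (\<Sum>j\<in>V. f j * M x j)"
      "(\<Sum>i\<in>V. \<Sum>j\<in>V. (f(x := t)) i * (f(x := t)) j * M i j) = (\<Sum>i\<in>V. \<Sum>j\<in>V. f i * f j * M i j)"
      using insert.hyps by (auto intro!: sum.cong)
    then show ?thesis
      using psd[of "f(x := t)"] unfolding split by simp
  qed
  have "?c \<ge> 0" using quad[of 1 "\<lambda>_. 0"] by simp
  show ?case
  proof (cases "?c = 0")
    case True
    have row: "M x y = 0" if "y \<in> V" for y
    proof (rule ccontr)
      assume "M x y \<noteq> 0"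
      let ?e = "\<lambda>i. if i = y then 1 else 0 :: real"
      have "(\<Sum>j\<in>V. ?e j * M x j) = M x y" "(\<Sum>i\<in>V. \<Sum>j\<in>V. ?e i * ?e j * M i j) = M y y"
        using that insert.hyps(1)
        by (simp_all add: sum_unit_vector mult.assoc flip: sum_distrib_left)
      (* a form that is affine in t cannot stay nonnegative unless its slope vanishes *)
      then show False
        using quad[of "- (M y y + 1) / (2 * M x y)" ?e] True \<open>M x y \<noteq> 0\<close>
        by (simp add: diff_divide_distrib left_diff_distrib)
    qed
    have "0 \<le> (\<Sum>i\<in>V. \<Sum>j\<in>V. f i * f j * M i j)" for f
      using quad[of 0 f] by simp
    with insert.IH[of M] sym obtain N :: nat and \<psi>
      where \<psi>: "\<forall>i\<in>V. \<forall>j\<in>V. M i j = (\<Sum>k<N. \<psi> i k * \<psi> j k)" by blast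
    have "\<forall>i\<in>insert x V. \<forall>j\<in>insert x V.
        M i j = (\<Sum>k<N. (\<psi>(x := \<lambda>_. 0)) i k * (\<psi>(x := \<lambda>_. 0)) j k)"
      using \<psi> True row sym insert.hyps(2) by auto
    then show ?thesis by blast
  next
    case False
    with \<open>?c \<ge> 0\<close> have c: "?c > 0" by simp
    let ?M = "\<lambda>i j. M i j - M x i * M x j / ?c"
    have "0 \<le> (\<Sum>i\<in>V. \<Sum>j\<in>V. f i * f j * ?M i j)" for f
    proof -
      let ?L = "\<Sum>j\<in>V. f j * M x j"
      have "(\<Sum>i\<in>V. \<Sum>j\<in>V. f i * f j * ?M i j) =
          (\<Sum>i\<in>V. \<Sum>j\<in>V. f i * f j * M i j - (f i * M x i) * (f j * M x j) / ?c)"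
        by (simp add: algebra_simps)
      also have "\<dots> = (\<Sum>i\<in>V. \<Sum>j\<in>V. f i * f j * M i j) - ?L * ?L / ?c"
        by (simp only: sum_subtractf sum_product sum_divide_distrib)
      also have "\<dots> \<ge> 0"
        (* t = - L / c minimises the quadratic polynomial in t *)
        using quad[of "- ?L / ?c" f] c by (simp add: field_simps)
      finally show ?thesis .
    qed
    moreover have "?M i j = ?M j i" if "i \<in> V" "j \<in> V" for i j
      using sym that by simp
    ultimately obtain N :: nat and \<psi>
      where \<psi>: "\<forall>i\<in>V. \<forall>j\<in>V. ?M i j = (\<Sum>k<N. \<psi> i k * \<psi> j k)"
      using insert.IH[of ?M] by blast
    define \<phi> where "\<phi> i k = (if k = N then M x i / sqrt ?c else if i = x then 0 else \<psi> i k)" for i k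
    have last: "\<phi> i N * \<phi> j N = M x i * M x j / ?c" for i j
      using c by (simp add: \<phi>_def)
    have "M i j = (\<Sum>k<Suc N. \<phi> i k * \<phi> j k)" if "i \<in> insert x V" "j \<in> insert x V" for i j
    proof (cases "i = x \<or> j = x")
      case True
      then have "(\<Sum>k<N. \<phi> i k * \<phi> j k) = 0"
        by (auto simp: \<phi>_def)
      then show ?thesis
        using True that sym[of i j] c by (auto simp: last)
    next
      case False
      then have "(\<Sum>k<N. \<phi> i k * \<phi> j k) = ?M i j"
        using \<psi> that by (auto simp: \<phi>_def)
      then show ?thesis by (simp add: last)
    qed
    then show ?thesis by blast
  qed
qed

theorem QE_class_iff_QEC_nonpos:
  assumes "pair_graph G" and "Digraph_Component.connected (with_proj G)"
  shows "QE_class G \<longleftrightarrow> QEC G \<le> 0"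
proof
  interpret pair_graph G by fact
  let ?V = "pverts G" and ?d = "graph_dist G"
  have fin: "finite ?V" by (rule pair_finite_verts)
  have ne: "?V \<noteq> {}" using assms connected_iff_reachable by blast
  assume "QE_class G"
  then obtain N :: nat and \<psi> where
    \<psi>: "\<And>i j. i \<in> ?V \<Longrightarrow> j \<in> ?V \<Longrightarrow> ?d i j = (\<Sum>k<N. (\<psi> i k - \<psi> j k)\<^sup>2)"
    unfolding QE_class_def by blast
  show "QEC G \<le> 0"
  proof (cases "card ?V = 1")
    case True
    then show ?thesis by (simp add: QEC_def)
  next
    case False
    moreover have "card ?V \<noteq> 0" using fin ne by simp
    ultimately have "card ?V \<ge> 2" by linarith
    then obtain f where f: "qec_admissible G f" "QEC G = dist_quad_form G f"
      using QEC_is_maximum(1)[OF fin] by blast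
    have f0: "sum f ?V = 0" using f(1) by (simp add: qec_admissible_def)
    have coord: "(\<Sum>i\<in>?V. \<Sum>j\<in>?V. f i * f j * (\<psi> i k - \<psi> j k)\<^sup>2) = - 2 * (\<Sum>i\<in>?V. f i * \<psi> i k)\<^sup>2"
      for k
    proof -
      have "(\<Sum>i\<in>?V. \<Sum>j\<in>?V. f i * f j * (\<psi> i k - \<psi> j k)\<^sup>2) =
          (\<Sum>i\<in>?V. \<Sum>j\<in>?V. (f i * (\<psi> i k)\<^sup>2) * f j + f i * (f j * (\<psi> j k)\<^sup>2)
            - 2 * ((f i * \<psi> i k) * (f j * \<psi> j k)))"
        by (intro sum.cong refl) (simp add: power2_eq_square algebra_simps)
      also have "\<dots> = - 2 * (\<Sum>i\<in>?V. f i * \<psi> i k)\<^sup>2"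
        unfolding sum.distrib sum_subtractf sum_distrib_left[symmetric] sum_product[symmetric]
        by (simp add: f0 power2_eq_square flip: sum_distrib_right)
      finally show ?thesis .
    qed
    have "dist_quad_form G f = (\<Sum>i\<in>?V. \<Sum>j\<in>?V. \<Sum>k<N. f i * f j * (\<psi> i k - \<psi> j k)\<^sup>2)"
      unfolding dist_quad_form_def sum_distrib_left
      by (intro sum.cong refl) (simp add: \<psi> sum_distrib_left sum_distrib_right mult_ac)
    also have "\<dots> = (\<Sum>i\<in>?V. \<Sum>k<N. \<Sum>j\<in>?V. f i * f j * (\<psi> i k - \<psi> j k)\<^sup>2)"
      by (intro sum.cong refl sum.swap)
    also have "\<dots> = (\<Sum>k<N. \<Sum>i\<in>?V. \<Sum>j\<in>?V. f i * f j * (\<psi> i k - \<psi> j k)\<^sup>2)"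
      by (rule sum.swap)
    also have "\<dots> \<le> 0"
      unfolding coord by (intro sum_nonpos) simp
    finally show ?thesis using f(2) by simp
  qed
next
  interpret pair_graph G by fact
  let ?V = "pverts G" and ?d = "graph_dist G"
  have fin: "finite ?V" by (rule pair_finite_verts)
  have ne: "?V \<noteq> {}" using assms connected_iff_reachable by blast
  then obtain b where b: "b \<in> ?V" by blast
  have self: "?d i i = 0" if "i \<in> ?V" for i
    by (rule graph_dist_self[OF pair_wf_digraph that])
  have comm: "?d i j = ?d j i" if "i \<in> ?V" "j \<in> ?V" for i j
    by (rule graph_dist_commute[OF assms that])
  assume nonpos: "QEC G \<le> 0"
  let ?M = "\<lambda>i j. (?d i b + ?d j b - ?d i j) / 2"
  have "0 \<le> (\<Sum>i\<in>?V. \<Sum>j\<in>?V. f i * f j * ?M i j)" for f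
  proof -
    let ?S = "sum f ?V" and ?T = "\<Sum>i\<in>?V. f i * ?d i b"
    let ?Q = "\<Sum>i\<in>?V. \<Sum>j\<in>?V. f i * f j * ?d i j"
    (* moving the total mass of f away at the base point gives a function with sum zero *)
    define e where "e i = (if i = b then 1 else 0 :: real)" for i
    let ?g = "\<lambda>i. f i - ?S * e i"
    have e: "(\<Sum>i\<in>?V. e i * F i) = F b" for F
      using b fin by (simp add: e_def sum_unit_vector)
    have "sum ?g ?V = 0"
      using e[of "\<lambda>_. 1"] by (simp add: sum_subtractf flip: sum_distrib_left)
    then have "dist_quad_form G ?g \<le> QEC G * (\<Sum>v\<in>?V. (?g v)\<^sup>2)"
      by (rule dist_quad_form_le_QEC[OF fin ne])
    also have "\<dots> \<le> 0"
      using nonpos by (intro mult_nonpos_nonneg sum_nonneg) auto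
    finally have "dist_quad_form G ?g \<le> 0" .
    moreover have "dist_quad_form G ?g = ?Q - 2 * ?S * ?T"
    proof -
      have row: "(\<Sum>j\<in>?V. ?d i j * ?g j) = (\<Sum>j\<in>?V. f j * ?d i j) - ?S * ?d i b" for i
      proof -
        have "(\<Sum>j\<in>?V. ?d i j * ?g j) = (\<Sum>j\<in>?V. f j * ?d i j) - ?S * (\<Sum>j\<in>?V. e j * ?d i j)"
          by (simp add: algebra_simps sum_subtractf sum_distrib_left)
        then show ?thesis unfolding e .
      qed
      have "dist_quad_form G ?g =
          (\<Sum>i\<in>?V. f i * ((\<Sum>j\<in>?V. f j * ?d i j) - ?S * ?d i b))
          - ?S * (\<Sum>i\<in>?V. e i * ((\<Sum>j\<in>?V. f j * ?d i j) - ?S * ?d i b))"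
        unfolding dist_quad_form_def row
        by (simp only: left_diff_distrib sum_subtractf sum_distrib_left mult.assoc)
      also have "\<dots> = (\<Sum>i\<in>?V. f i * (\<Sum>j\<in>?V. f j * ?d i j)) - ?S * ?T - ?S * (\<Sum>j\<in>?V. f j * ?d b j)"
        unfolding e by (simp add: self b right_diff_distrib sum_subtractf sum_distrib_left mult_ac)
      also have "(\<Sum>j\<in>?V. f j * ?d b j) = ?T"
        by (intro sum.cong refl) (simp add: comm b)
      also have "(\<Sum>i\<in>?V. f i * (\<Sum>j\<in>?V. f j * ?d i j)) = ?Q"
        by (simp add: sum_distrib_left mult.assoc)
      finally show ?thesis by simp
    qed
    moreover have "(\<Sum>i\<in>?V. \<Sum>j\<in>?V. f i * f j * ?M i j) = (2 * ?S * ?T - ?Q) / 2"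
    proof -
      have "(\<Sum>i\<in>?V. \<Sum>j\<in>?V. f i * f j * ?M i j) =
          (\<Sum>i\<in>?V. \<Sum>j\<in>?V. ((f i * ?d i b) * f j + f i * (f j * ?d j b) - f i * f j * ?d i j) / 2)"
        by (simp add: algebra_simps)
      also have "\<dots> = (?T * ?S + ?S * ?T - ?Q) / 2"
        by (simp only: sum_subtractf sum.distrib sum_product sum_divide_distrib[symmetric])
      finally show ?thesis by simp
    qed
    ultimately show ?thesis by simp
  qed
  moreover have "?M i j = ?M j i" if "i \<in> ?V" "j \<in> ?V" for i j
    using comm that by simp
  ultimately obtain N :: nat and \<psi>
    where \<psi>: "\<forall>i\<in>?V. \<forall>j\<in>?V. ?M i j = (\<Sum>k<N. \<psi> i k * \<psi> j k)"
    using psd_imp_gram[OF fin, of ?M] by blast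
  have "?d i j = (\<Sum>k<N. (\<psi> i k - \<psi> j k)\<^sup>2)" if ij: "i \<in> ?V" "j \<in> ?V" for i j
  proof -
    have "(\<Sum>k<N. (\<psi> i k - \<psi> j k)\<^sup>2) =
        (\<Sum>k<N. \<psi> i k * \<psi> i k) + (\<Sum>k<N. \<psi> j k * \<psi> j k) - 2 * (\<Sum>k<N. \<psi> i k * \<psi> j k)"
      by (simp add: power2_eq_square algebra_simps sum.distrib sum_subtractf sum_distrib_left)
    also have "\<dots> = ?M i i + ?M j j - 2 * ?M i j"
      by (simp only: \<psi>[rule_format, OF ij] \<psi>[rule_format, OF ij(1) ij(1)]
          \<psi>[rule_format, OF ij(2) ij(2)])
    also have "\<dots> = ?d i j"
      using self ij by (simp add: field_simps)
    finally show ?thesis by simp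
  qed
  then show "QE_class G" unfolding QE_class_def by blast
qed

section \<open>Complete bipartite graphs\<close>

lemma connected_complete_bipartite:
  assumes "complete_bipartite_digraph m n (with_proj K)" and "m \<ge> 1" "n \<ge> 1"
  shows "Digraph_Component.connected (with_proj K)"
proof -
  interpret pair_graph K using assms(1) by (rule pair_graphI_complete_bipartite)
  obtain U W where UW: "pverts K = U \<union> W" "card U = m" "card W = n" "parcs K = U \<times> W \<union> W \<times> U"
    using assms(1) unfolding complete_bipartite_digraph_pair_def by blast
  obtain a b where ab: "a \<in> U" "b \<in> W"
    using assms(2,3) UW(2,3) by fastforce
  (* every vertex is linked to a, possibly via b *)
  have "v \<rightarrow>\<^sup>*\<^bsub>with_proj K\<^esub> a" if "v \<in> pverts K" for v
  proof -
    have "(b, a) \<in> parcs K" and "v \<in> W \<Longrightarrow> (v, a) \<in> parcs K" and "v \<in> U \<Longrightarrow> (v, b) \<in> parcs K"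
      using ab UW(4) by auto
    then show ?thesis
      using that UW(1) by (auto intro: reachable_trans reachable_adjI)
  qed
  then have "u \<rightarrow>\<^sup>*\<^bsub>with_proj K\<^esub> v" if "u \<in> pverts K" "v \<in> pverts K" for u v
    using that by (meson reachable_trans symmetric_reachable[OF pair_sym_arcs])
  then show ?thesis
    using ab UW(1) unfolding connected_iff_reachable[OF pair_graph] by blast
qed

lemma graph_dist_complete_bipartite:
  assumes K: "pair_wf_digraph K" "pverts K = U \<union> W" "U \<inter> W = {}" "parcs K = U \<times> W \<union> W \<times> U"
    and ne: "U \<noteq> {}" "W \<noteq> {}" and xy: "x \<in> pverts K" "y \<in> pverts K"
  shows "graph_dist K x y = (if x = y then 0 else if x \<in> U \<longleftrightarrow> y \<in> U then 2 else 1)"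
proof -
  have dist: "graph_dist K x y = real k"
    if "(x, y) \<in> parcs K ^^ k" "\<And>j. (x, y) \<in> parcs K ^^ j \<Longrightarrow> k \<le> j" for k
    using graph_dist_eqI[OF K(1) xy(1)] that by blast
  consider "x = y" | "x \<noteq> y" "x \<in> U \<longleftrightarrow> y \<in> U" | "x \<in> U \<longleftrightarrow> y \<notin> U" by blast
  then show ?thesis
  proof cases
    case 1
    then show ?thesis using dist[of 0] by simp
  next
    case 2
    have "\<exists>z. (x, z) \<in> parcs K \<and> (z, y) \<in> parcs K"
      using 2 xy K(2,4) ne by (cases "x \<in> U") auto
    then have "(x, y) \<in> parcs K ^^ 2"
      by (auto simp: numeral_2_eq_2)
    moreover have "2 \<le> j" if "(x, y) \<in> parcs K ^^ j" for j
    proof -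
      have "(x, y) \<notin> parcs K" using 2 K(3,4) by auto
      then have "j \<noteq> 1" using that by (metis relpow_1)
      moreover have "j \<noteq> 0" using that 2 by (metis relpow_0_E)
      ultimately show ?thesis by linarith
    qed
    ultimately show ?thesis using dist[of 2] 2 by simp
  next
    case 3
    then have "(x, y) \<in> parcs K ^^ 1" using xy K(2,4) by auto
    moreover have "1 \<le> j" if "(x, y) \<in> parcs K ^^ j" for j
      using that 3 by (cases j) auto
    ultimately show ?thesis using dist[of 1] 3 by auto
  qed
qed

text \<open>
  On each part \<open>D\<close> is \<open>2 (J - I)\<close>, and \<open>J\<close> between the parts. With sums \<open>A\<close> and \<open>-A\<close> over the parts the
  form is \<open>2 A\<^sup>2 + 2 A\<^sup>2 - 2 A\<^sup>2 - 2 |f|\<^sup>2\<close>.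
\<close>
lemma dist_quad_form_complete_bipartite:
  assumes K: "pair_wf_digraph K" "pverts K = U \<union> W" "U \<inter> W = {}" "parcs K = U \<times> W \<union> W \<times> U"
    and ne: "U \<noteq> {}" "W \<noteq> {}" and fin: "finite U" "finite W" and sum0: "sum f (U \<union> W) = 0"
  shows "dist_quad_form K f = 2 * (sum f U)\<^sup>2 - 2 * (\<Sum>v\<in>U \<union> W. (f v)\<^sup>2)"
proof -
  note dist = graph_dist_complete_bipartite[OF K ne]
  have W: "sum f W = - sum f U"
    using sum0 fin K(3) by (simp add: sum.union_disjoint)
  have rowU: "(\<Sum>y\<in>U \<union> W. graph_dist K x y * f y) = 2 * sum f U + sum f W - 2 * f x" if "x \<in> U" for x
  proof -
    have "(\<Sum>y\<in>U. graph_dist K x y * f y) = (\<Sum>y\<in>U. 2 * f y - (if y = x then 2 * f x else 0))"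
      using that K(2) by (intro sum.cong refl) (auto simp: dist)
    also have "\<dots> = 2 * sum f U - 2 * f x"
      using that fin by (simp add: sum_subtractf sum_distrib_left)
    finally have "(\<Sum>y\<in>U. graph_dist K x y * f y) = 2 * sum f U - 2 * f x" .
    moreover have "(\<Sum>y\<in>W. graph_dist K x y * f y) = sum f W"
      using that K(2,3) by (intro sum.cong refl) (auto simp: dist)
    ultimately show ?thesis
      using fin K(3) by (simp add: sum.union_disjoint)
  qed
  have rowW: "(\<Sum>y\<in>U \<union> W. graph_dist K x y * f y) = sum f U + 2 * sum f W - 2 * f x" if "x \<in> W" for x
  proof -
    have "(\<Sum>y\<in>W. graph_dist K x y * f y) = (\<Sum>y\<in>W. 2 * f y - (if y = x then 2 * f x else 0))"
      using that K(2,3) by (intro sum.cong refl) (auto simp: dist)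
    also have "\<dots> = 2 * sum f W - 2 * f x"
      using that fin by (simp add: sum_subtractf sum_distrib_left)
    finally have "(\<Sum>y\<in>W. graph_dist K x y * f y) = 2 * sum f W - 2 * f x" .
    moreover have "(\<Sum>y\<in>U. graph_dist K x y * f y) = sum f U"
      using that K(2,3) by (intro sum.cong refl) (auto simp: dist)
    ultimately show ?thesis
      using fin K(3) by (simp add: sum.union_disjoint)
  qed
  have "dist_quad_form K f = (\<Sum>x\<in>U. f x * (\<Sum>y\<in>U \<union> W. graph_dist K x y * f y))
      + (\<Sum>x\<in>W. f x * (\<Sum>y\<in>U \<union> W. graph_dist K x y * f y))"
    unfolding dist_quad_form_def K(2) by (rule sum.union_disjoint[OF fin K(3)])
  also have "\<dots> = (\<Sum>x\<in>U. f x * (sum f U - 2 * f x)) + (\<Sum>x\<in>W. f x * (- sum f U - 2 * f x))"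
    by (simp add: rowU rowW W)
  also have "\<dots> = sum f U * sum f U - 2 * (\<Sum>x\<in>U. (f x)\<^sup>2) + (- sum f U * sum f W - 2 * (\<Sum>x\<in>W. (f x)\<^sup>2))"
    by (simp add: right_diff_distrib sum_subtractf sum_negf sum_distrib_left sum_distrib_right
        power2_eq_square mult_ac)
  finally show ?thesis
    using fin K(3) by (simp add: W sum.union_disjoint power2_eq_square)
qed

theorem QEC_complete_bipartite:
  assumes "complete_bipartite_digraph m n (with_proj K)" and "m \<ge> 1" "n \<ge> 1"
  shows "QEC K = 2 * real m * real n / (real m + real n) - 2"
proof -
  interpret pair_graph K using assms(1) by (rule pair_graphI_complete_bipartite)
  obtain U W where UW: "pverts K = U \<union> W" "U \<inter> W = {}" "card U = m" "card W = n"
      "parcs K = U \<times> W \<union> W \<times> U"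
    using assms(1) unfolding complete_bipartite_digraph_pair_def by blast
  have fin: "finite U" "finite W" using pair_finite_verts UW(1) by simp_all
  have ne: "U \<noteq> {}" "W \<noteq> {}" using assms(2,3) UW(3,4) by auto
  note form = dist_quad_form_complete_bipartite[OF pair_wf_digraph UW(1,2,5) ne fin]
  have pos: "real m > 0" "real n > 0" using assms(2,3) by simp_all
  (* the unit vector in the direction of 1/m on one part and -1/n on the other *)
  define c where "c = sqrt (real m * real n / (real m + real n))"
  have c: "c * c = real m * real n / (real m + real n)"
    using pos by (simp add: c_def)
  define f where "f v = (if v \<in> U then c / m else - c / n)" for v
  have fU: "sum f U = c"
    using pos UW(3) by (simp add: f_def)
  have fW: "sum F W = n * F' " if "\<And>v. v \<in> W \<Longrightarrow> F v = F'" for F and F' :: real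
    using that UW(4) by simp
  have W_not_U: "v \<notin> U" if "v \<in> W" for v using that UW(2) by blast
  have "sum f W = - c"
    using fW[of f "- c / n"] W_not_U pos by (simp add: f_def)
  then have sum0: "sum f (U \<union> W) = 0"
    using fU fin UW(2) by (simp add: sum.union_disjoint)
  have "(\<Sum>v\<in>W. f v * f v) = c * c / n"
    using fW[of "\<lambda>v. f v * f v" "c / n * (c / n)"] W_not_U pos by (simp add: f_def)
  moreover have "(\<Sum>v\<in>U. f v * f v) = c * c / m"
    using pos UW(3) by (simp add: f_def)
  moreover have "c * c / m + c * c / n = 1"
    using pos unfolding c by (simp add: add.commute flip: add_divide_distrib)
  ultimately have norm: "(\<Sum>v\<in>U \<union> W. f v * f v) = 1"
    by (simp only: sum.union_disjoint[OF fin UW(2)])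
  show ?thesis
  proof (rule QEC_eqI)
    show "finite (pverts K)" by (rule pair_finite_verts)
    show "card (pverts K) \<ge> 2"
      using fin UW assms(2,3) by (simp add: card_Un_disjoint)
    show "qec_admissible K f"
      using sum0 norm UW(1) by (simp add: qec_admissible_def)
    show "2 * real m * real n / (real m + real n) - 2 \<le> dist_quad_form K f"
      using form[OF sum0] fU norm c by (simp add: power2_eq_square)
  next
    fix g assume g: "qec_admissible K g"
    then have g0: "sum g (U \<union> W) = 0" and g1: "(\<Sum>v\<in>U \<union> W. (g v)\<^sup>2) = 1"
      using UW(1) by (simp_all add: qec_admissible_def power2_eq_square)
    have gW: "sum g W = - sum g U"
      using g0 fin UW(2) by (simp add: sum.union_disjoint)
    have "(sum g U)\<^sup>2 / m \<le> (\<Sum>v\<in>U. (g v)\<^sup>2)" "(sum g W)\<^sup>2 / n \<le> (\<Sum>v\<in>W. (g v)\<^sup>2)"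
      using sum_squared_le_sum_of_squares[of g U] sum_squared_le_sum_of_squares[of g W] fin ne pos UW(3,4)
      by (simp_all add: field_simps)
    then have "(sum g U)\<^sup>2 / m + (sum g U)\<^sup>2 / n \<le> 1"
      using g1 fin UW(2) by (simp add: sum.union_disjoint gW)
    then have "(sum g U)\<^sup>2 \<le> real m * real n / (real m + real n)"
      using pos by (simp add: field_simps)
    then show "dist_quad_form K g \<le> 2 * real m * real n / (real m + real n) - 2"
      using form[OF g0] g1 by simp
  qed
qed

section \<open>Products with a complete bipartite graph\<close>

theorem theorem1p5:
  fixes G :: "'a pair_pre_digraph" and K :: "'b pair_pre_digraph" and l m n :: nat
  assumes "pair_graph G" and "Digraph_Component.connected (with_proj G)" and "card (pverts G) = l"
    and "m \<ge> 1" and "n \<ge> 1" and "complete_bipartite_digraph m n (with_proj K)"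
  shows "(QE_class K \<and> \<not> QE_class G \<longrightarrow>
            QEC (cartesian_product K G) = (real m + real n) * QEC G)
       \<and> (\<not> QE_class K \<longrightarrow>
            QEC (cartesian_product K G) =
              max ((real m + real n) * QEC G)
                  (real l * ((real n * (real m - 2) + real m * (real n - 2)) / (real m + real n))))"
proof -
  have K: "pair_graph K" "Digraph_Component.connected (with_proj K)"
    using assms(4-6) pair_graphI_complete_bipartite connected_complete_bipartite by blast+
  have card: "card (pverts K) = m + n"
    using assms(6) unfolding complete_bipartite_digraph_pair_def
    by (metis card_Un_disjoint finite_Un)
  have QEC_K: "QEC K = (real n * (real m - 2) + real m * (real n - 2)) / (real m + real n)"
    using QEC_complete_bipartite[OF assms(6,4,5)] assms(4,5) by (simp add: field_simps)
  have product: "QEC (cartesian_product K G) = max ((real m + real n) * QEC G) (real l * QEC K)"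
    if "\<not> QE_class K \<or> \<not> QE_class G"
    using QEC_cartesian_product[OF K assms(1,2)] that card assms(3)
      QE_class_iff_QEC_nonpos[OF K] QE_class_iff_QEC_nonpos[OF assms(1,2)]
    by (simp add: max.commute not_le)
  show ?thesis
  proof (intro conjI impI)
    assume "QE_class K \<and> \<not> QE_class G"
    then have "QEC K \<le> 0" "QEC G > 0"
      using QE_class_iff_QEC_nonpos[OF K] QE_class_iff_QEC_nonpos[OF assms(1,2)] by simp_all
    then have "real l * QEC K \<le> 0" "0 \<le> (real m + real n) * QEC G"
      by (simp_all add: mult_nonneg_nonpos)
    then show "QEC (cartesian_product K G) = (real m + real n) * QEC G"
      using product \<open>QE_class K \<and> \<not> QE_class G\<close> by simp
  next
    assume "\<not> QE_class K"
    then show "QEC (cartesian_product K G) =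
        max ((real m + real n) * QEC G)
            (real l * ((real n * (real m - 2) + real m * (real n - 2)) / (real m + real n)))"
      using product by (simp only: QEC_K simp_thms)
  qed
qed

end
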